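(* Let $G$ and $H$ be two oligomorphic groups acting on (at most countable) sets $A$ and $B$ respectively, and let $G\times H$ act on $A\times B$ by the product action. Then there is an isomorphism of species $$F_{G\times H}=F_G\,\widetilde{\boxdot}\,F_H.$$
   Context: A species of structures is a functor $F$ from the category of finite sets and bijections to itself; $F[U]$ is the finite set of $F$-structures on $U$. Equality of species means natural isomorphism. For an at most countable set $A$ and a finite set $U$, $(A)_U$ is the set of injective functions $U\to A$. A permutation group $G$ on $A$ is oligomorphic if it has only finitely many orbits on the set $A^U$ of functions $U\to A$ for every finite set $U$ (action $g\cdot f=g\circ f$). The species $F_G$ is defined by $F_G[U]=(A)_U/G$, the set of $G$-orbits $\overline{f}$ of injective functions $f:U\to A$; a bijection $\sigma:U\to V$ acts by $F_G[\sigma](\overline{f})=\overline{f\circ\sigma^{-1}}$. The product action is $(g,h)\cdot(a,b)=(g a,h b)$, and $F_{G\times H}$ is formed with respect to $A\times B$. A partial rectangle on a finite set $U$ is an ordered pair $(\pi,\tau)$ of set partitions of $U$ with $\pi\wedge\tau=\hat0$, i.e. $|B\cap C|\le1$ for all blocks $B\in\pi$, $C\in\tau$. $P_{\mathcal{R}}[U]$ is the set of partial rectangles on $U$. The modified arithmetic product of species $M,N$ is $$(M\widetilde{\boxdot}N)[U]=\sum_{(\pi,\tau)\in P_{\mathcal{R}}[U]}M[\pi]\times N[\tau]$$ (disjoint union), with transport along $\sigma:U\to V$ given by $(\pi,\tau,m,n)\mapsto(\sigma(\pi),\sigma(\tau),M[\sigma^\pi](m),N[\sigma^\tau](n))$,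 where $\sigma(\pi)=\{\sigma(S)\mid S\in\pi\}$, $\sigma^\pi(S)=\sigma(S)$, and similarly for $\tau$. *)

theory Defs
  imports
    "HOL-Library.FuncSet"
    "HOL-Library.Disjoint_Sets"
    "HOL-Library.Countable_Set"
    "HOL-Algebra.Group_Action"
begin

section \<open>Species of structures\<close>

text \<open>
  The finite sets are the finite subsets of a type \<open>'u\<close>, which is always left arbitrary; the
  structures have type \<open>'s\<close>. Concrete species are defined polymorphically in \<open>'u\<close>, so that they can
  be evaluated both on a set \<open>U :: 'u set\<close> and on a partition \<open>\<pi> :: 'u set set\<close> of it.

  \<open>transport F U V \<sigma>\<close> is the map \<open>F[\<sigma>]\<close> for a bijection \<open>\<sigma>\<close> from \<open>U\<close> to \<open>V\<close>. As \<open>\<sigma>\<close> is a total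
  HOL function of which only the values on \<open>U\<close> matter, a functor has to satisfy the congruence
  law \<open>transport_cong\<close> in addition to the two functor laws.
\<close>

record ('u, 's) pre_species =
  structures :: "'u set \<Rightarrow> 's set"
  transport :: "'u set \<Rightarrow> 'u set \<Rightarrow> ('u \<Rightarrow> 'u) \<Rightarrow> 's \<Rightarrow> 's"

locale species =
  fixes F :: "('u, 's) pre_species"
  assumes finite_structures: "finite U \<Longrightarrow> finite (structures F U)"
    and transport_bij:
      "\<lbrakk>finite U; bij_betw \<sigma> U V\<rbrakk>
        \<Longrightarrow> bij_betw (transport F U V \<sigma>) (structures F U) (structures F V)"
    and transport_cong:
      "\<lbrakk>finite U; bij_betw \<sigma> U V; \<And>x. x \<in> U \<Longrightarrow> \<sigma> x = \<sigma>' x; s \<in> structures F U\<rbrakk>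
        \<Longrightarrow> transport F U V \<sigma> s = transport F U V \<sigma>' s"
    and transport_id:
      "\<lbrakk>finite U; s \<in> structures F U\<rbrakk> \<Longrightarrow> transport F U U id s = s"
    and transport_comp:
      "\<lbrakk>finite U; bij_betw \<sigma> U V; bij_betw \<tau> V W; s \<in> structures F U\<rbrakk>
        \<Longrightarrow> transport F U W (\<tau> \<circ> \<sigma>) s = transport F V W \<tau> (transport F U V \<sigma> s)"

definition species_iso :: "('u, 's) pre_species \<Rightarrow> ('u, 't) pre_species \<Rightarrow> bool" where
  "species_iso F F' \<longleftrightarrow>
     species F \<and> species F' \<and>
     (\<exists>\<eta>. (\<forall>U. finite U \<longrightarrow> bij_betw (\<eta> U) (structures F U) (structures F' U)) \<and>
          (\<forall>U V \<sigma>. finite U \<and> bij_betw \<sigma> U V \<longrightarrow>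
             (\<forall>s \<in> structures F U.
                \<eta> V (transport F U V \<sigma> s) = transport F' U V \<sigma> (\<eta> U s))))"


section \<open>Oligomorphic groups and their species\<close>

text \<open>
  The action of \<open>G\<close> on functions defined on \<open>U\<close>, \<open>g \<cdot> f = g \<circ> f\<close>. Functions from \<open>U\<close> to \<open>A\<close> are the
  elements of \<open>U \<rightarrow>\<^sub>E A\<close>, hence the use of \<^const>\<open>compose\<close>, which is \<open>undefined\<close> outside \<open>U\<close>.
\<close>

definition fun_action :: "'u set \<Rightarrow> ('g \<Rightarrow> 'a \<Rightarrow> 'a) \<Rightarrow> 'g \<Rightarrow> ('u \<Rightarrow> 'a) \<Rightarrow> 'u \<Rightarrow> 'a" where
  "fun_action U \<phi> g f = compose U (\<phi> g) f"

text \<open>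
  A definition cannot quantify over all types of index sets; since the number of orbits on \<open>A\<^sup>U\<close>
  only depends on the cardinality of \<open>U\<close>, finite sets of natural numbers represent all of them.
\<close>

locale oligomorphic = group_action G A \<phi>
  for G :: "('g, 'x) monoid_scheme" (structure)
    and A :: "'a set"
    and \<phi> :: "'g \<Rightarrow> 'a \<Rightarrow> 'a" +
  assumes finite_orbits:
    "finite (U :: nat set) \<Longrightarrow> finite (orbits G (U \<rightarrow>\<^sub>E A) (fun_action U \<phi>))"

definition injections :: "'u set \<Rightarrow> 'a set \<Rightarrow> ('u \<Rightarrow> 'a) set" where
  "injections U A = {f \<in> U \<rightarrow>\<^sub>E A. inj_on f U}"

text \<open>
  The transport sends the orbit of \<open>f\<close> to the orbit of \<open>f \<circ> \<sigma>\<^sup>-\<^sup>1\<close>. To avoid choosing a representative,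
  it is written as the image of the orbit under precomposition with \<open>\<sigma>\<^sup>-\<^sup>1\<close>; this is the same set
  because precomposition commutes with the action.
\<close>

definition orbit_species ::
  "('g, 'x) monoid_scheme \<Rightarrow> 'a set \<Rightarrow> ('g \<Rightarrow> 'a \<Rightarrow> 'a) \<Rightarrow> ('u, ('u \<Rightarrow> 'a) set) pre_species"
where
  "orbit_species G A \<phi> =
     \<lparr>structures = (\<lambda>U. orbits G (injections U A) (fun_action U \<phi>)),
      transport = (\<lambda>U V \<sigma> X. (\<lambda>f. compose V f (inv_into U \<sigma>)) ` X)\<rparr>"

text \<open>
  The action of \<open>G \<times>\<times> H\<close> on \<open>A \<times> B\<close>, cut down to \<open>A \<times> B\<close> because elements of
  \<^term>\<open>BijGroup (A \<times> B)\<close> are extensional.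
\<close>

definition prod_action ::
  "'a set \<Rightarrow> 'b set \<Rightarrow> ('g \<Rightarrow> 'a \<Rightarrow> 'a) \<Rightarrow> ('h \<Rightarrow> 'b \<Rightarrow> 'b) \<Rightarrow> 'g \<times> 'h \<Rightarrow> 'a \<times> 'b \<Rightarrow> 'a \<times> 'b"
where
  "prod_action A B \<phi> \<psi> = (\<lambda>(g, h). \<lambda>(a, b) \<in> A \<times> B. (\<phi> g a, \<psi> h b))"


section \<open>The modified arithmetic product\<close>

definition partial_rectangles :: "'u set \<Rightarrow> ('u set set \<times> 'u set set) set" where
  "partial_rectangles U =
     {(\<pi>, \<tau>). partition_on U \<pi> \<and> partition_on U \<tau> \<and> (\<forall>B \<in> \<pi>. \<forall>C \<in> \<tau>. card (B \<inter> C) \<le> 1)}"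

text \<open>Below, \<open>\<sigma>(\<pi>)\<close> is \<open>(`) \<sigma> ` \<pi>\<close>, and \<open>(`) \<sigma>\<close> is the induced bijection \<open>\<sigma>\<^sup>\<pi>\<close> from \<open>\<pi>\<close> to \<open>\<sigma>(\<pi>)\<close>.\<close>

definition modified_arith_prod ::
  "('u set, 's) pre_species \<Rightarrow> ('u set, 't) pre_species \<Rightarrow>
   ('u, 'u set set \<times> 'u set set \<times> 's \<times> 't) pre_species"
where
  "modified_arith_prod M N =
     \<lparr>structures = (\<lambda>U. {(\<pi>, \<tau>, m, n). (\<pi>, \<tau>) \<in> partial_rectangles U \<and>
                                        m \<in> structures M \<pi> \<and> n \<in> structures N \<tau>}),
      transport = (\<lambda>U V \<sigma> (\<pi>, \<tau>, m, n).
        ((`) \<sigma> ` \<pi>, (`) \<sigma> ` \<tau>,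
         transport M \<pi> ((`) \<sigma> ` \<pi>) ((`) \<sigma>) m,
         transport N \<tau> ((`) \<sigma> ` \<tau>) ((`) \<sigma>) n))\<rparr>"

end

theory Submission
  imports Defs
begin

text \<open>
  A function \<open>f : U \<rightarrow> A \<times> B\<close> is a pair of functions \<open>k : U \<rightarrow> A\<close> and \<open>l : U \<rightarrow> B\<close>. Each of them
  factors uniquely as the projection of \<open>U\<close> onto a partition (the fibres of the function) followed
  by an injective function on the blocks, so that \<open>f\<close> amounts to two partitions \<open>\<pi>\<close>, \<open>\<tau>\<close> of \<open>U\<close> and
  two injections \<open>p : \<pi> \<rightarrow> A\<close>, \<open>q : \<tau> \<rightarrow> B\<close> (\<open>pullback_exists\<close>, \<open>pullback_inject\<close>). The function \<open>f\<close>
  is injective exactly if no two points of \<open>U\<close> share both their \<open>\<pi>\<close>-block and their \<open>\<tau>\<close>-block, that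
  is, if \<open>(\<pi>, \<tau>)\<close> is a partial rectangle (\<open>inj_on_pair_pullback_iff\<close>).

  The groups act on values only. Hence \<open>(g, h)\<close> replaces \<open>p\<close> by \<open>g \<circ> p\<close> and \<open>q\<close> by \<open>h \<circ> q\<close> and leaves
  the partitions alone, and an orbit of injections \<open>U \<rightarrow> A \<times> B\<close> is the same as a partial rectangle
  together with an orbit of injections \<open>\<pi> \<rightarrow> A\<close> and, independently, an orbit of injections
  \<open>\<tau> \<rightarrow> B\<close> (\<open>bij_betw_glue\<close>). Relabelling \<open>U\<close> relabels the blocks and does not change values, whence
  naturality (\<open>glue_natural\<close>).

  The bijection is written from the product \<open>F\<^sub>G \<boxdot> F\<^sub>H\<close> to \<open>F\<^bsub>G \<times> H\<^esub>\<close>, because in this direction it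
  needs no representatives: \<open>(\<pi>, \<tau>, m, n)\<close> goes to the set of all functions glued from a \<open>p \<in> m\<close> and
  a \<open>q \<in> n\<close>. The same bijection shows that \<open>F\<^bsub>G \<times> H\<^esub>\<close> has finitely many structures on each finite
  set, since a finite set has finitely many partitions and \<open>F\<^sub>G\<close>, \<open>F\<^sub>H\<close> have finitely many structures
  on each of them.
\<close>

section \<open>Species\<close>

text \<open>
  Bijectivity of transport is automatic: transport along the inverse bijection is a two-sided
  inverse by the other functor laws.
\<close>

lemma speciesI:
  assumes fin: "\<And>U. finite U \<Longrightarrow> finite (structures F U)"
    and maps: "\<And>U V \<sigma> s. \<lbrakk>finite U; bij_betw \<sigma> U V; s \<in> structures F U\<rbrakk>
      \<Longrightarrow> transport F U V \<sigma> s \<in> structures F V"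
    and cong: "\<And>U V \<sigma> \<sigma>' s.
      \<lbrakk>finite U; bij_betw \<sigma> U V; \<And>x. x \<in> U \<Longrightarrow> \<sigma> x = \<sigma>' x; s \<in> structures F U\<rbrakk>
        \<Longrightarrow> transport F U V \<sigma> s = transport F U V \<sigma>' s"
    and ident: "\<And>U s. \<lbrakk>finite U; s \<in> structures F U\<rbrakk> \<Longrightarrow> transport F U U id s = s"
    and comp: "\<And>U V W \<sigma> \<tau> s.
      \<lbrakk>finite U; bij_betw \<sigma> U V; bij_betw \<tau> V W; s \<in> structures F U\<rbrakk>
        \<Longrightarrow> transport F U W (\<tau> \<circ> \<sigma>) s = transport F V W \<tau> (transport F U V \<sigma> s)"
  shows "species F"
proof -
  have inverse: "transport F V U \<rho> (transport F U V \<sigma> s) = s"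
    if "finite U" "bij_betw \<sigma> U V" "bij_betw \<rho> V U" "s \<in> structures F U"
      and \<rho>: "\<And>x. x \<in> U \<Longrightarrow> \<rho> (\<sigma> x) = x" for U V \<sigma> \<rho> s
  proof -
    have "transport F V U \<rho> (transport F U V \<sigma> s) = transport F U U (\<rho> \<circ> \<sigma>) s"
      using comp that by simp
    also have "\<dots> = transport F U U id s"
      by (rule cong) (use that bij_betw_trans in auto)
    finally show ?thesis using ident that by simp
  qed
  have "bij_betw (transport F U V \<sigma>) (structures F U) (structures F V)"
    if U: "finite U" and \<sigma>: "bij_betw \<sigma> U V" for U V \<sigma>
  proof (rule bij_betw_byWitness[where f' = "transport F V U (inv_into U \<sigma>)"])
    have V: "finite V" using bij_betw_finite[OF \<sigma>] U by simp
    have \<rho>: "bij_betw (inv_into U \<sigma>) V U" by (rule bij_betw_inv_into[OF \<sigma>])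
    show "\<forall>s\<in>structures F U. transport F V U (inv_into U \<sigma>) (transport F U V \<sigma> s) = s"
      using inverse[OF U \<sigma> \<rho>] bij_betw_inv_into_left[OF \<sigma>] by simp
    show "\<forall>s\<in>structures F V. transport F U V \<sigma> (transport F V U (inv_into U \<sigma>) s) = s"
      using inverse[OF V \<rho> \<sigma>] bij_betw_inv_into_right[OF \<sigma>] by simp
    show "transport F U V \<sigma> ` structures F U \<subseteq> structures F V"
      using maps[OF U \<sigma>] by blast
    show "transport F V U (inv_into U \<sigma>) ` structures F V \<subseteq> structures F U"
      using maps[OF V \<rho>] by blast
  qed
  then show ?thesis
    by - (rule species.intro, (assumption | rule fin cong ident comp | simp)+)
qed

lemma (in species) transport_in:
  assumes "finite U" "bij_betw \<sigma> U V" "s \<in> structures F U"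
  shows "transport F U V \<sigma> s \<in> structures F V"
  using bij_betwE[OF transport_bij] assms by blast

lemma species_isoI:
  assumes "species F" and "species F'"
    and "\<And>U. finite U \<Longrightarrow> bij_betw (\<eta> U) (structures F U) (structures F' U)"
    and "\<And>U V \<sigma> s. \<lbrakk>finite U; bij_betw \<sigma> U V; s \<in> structures F U\<rbrakk>
      \<Longrightarrow> \<eta> V (transport F U V \<sigma> s) = transport F' U V \<sigma> (\<eta> U s)"
  shows "species_iso F F'"
  unfolding species_iso_def
  by (intro conjI exI[of _ \<eta>] allI impI ballI) (simp_all add: assms)

lemma species_iso_sym:
  fixes F :: "('u, 's) pre_species" and F' :: "('u, 't) pre_species"
  assumes "species_iso F F'"
  shows "species_iso F' F"
proof -
  have F: "species F" and F': "species F'"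
    using assms by (simp_all add: species_iso_def)
  obtain \<eta> where "\<forall>U. finite U \<longrightarrow> bij_betw (\<eta> U) (structures F U) (structures F' U)"
    and "\<forall>U V \<sigma>. finite U \<and> bij_betw \<sigma> U V \<longrightarrow>
      (\<forall>s\<in>structures F U. \<eta> V (transport F U V \<sigma> s) = transport F' U V \<sigma> (\<eta> U s))"
    using assms unfolding species_iso_def by (elim conjE exE)
  then have bij: "\<And>U. finite U \<Longrightarrow> bij_betw (\<eta> U) (structures F U) (structures F' U)"
    and nat: "\<And>U V \<sigma> s. \<lbrakk>finite U; bij_betw \<sigma> U V; s \<in> structures F U\<rbrakk>
      \<Longrightarrow> \<eta> V (transport F U V \<sigma> s) = transport F' U V \<sigma> (\<eta> U s)"
    by simp_all
  define \<theta> where "\<theta> U = inv_into (structures F U) (\<eta> U)" for U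
  show ?thesis
  proof (rule species_isoI[OF F' F])
    show "bij_betw (\<theta> U) (structures F' U) (structures F U)" if "finite U" for U
      unfolding \<theta>_def by (rule bij_betw_inv_into[OF bij[OF that]])
    fix U V :: "'u set" and \<sigma> s
    assume U: "finite U" and \<sigma>: "bij_betw \<sigma> U V" and s: "s \<in> structures F' U"
    have V: "finite V" using bij_betw_finite[OF \<sigma>] U by simp
    have t: "\<theta> U s \<in> structures F U" and \<eta>t: "\<eta> U (\<theta> U s) = s"
      using bij_betwE[OF bij_betw_inv_into[OF bij[OF U]]] bij_betw_inv_into_right[OF bij[OF U]] s
      unfolding \<theta>_def by auto
    have "transport F' U V \<sigma> s = \<eta> V (transport F U V \<sigma> (\<theta> U s))"
      using nat[OF U \<sigma> t] \<eta>t by simp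
    then show "\<theta> V (transport F' U V \<sigma> s) = transport F U V \<sigma> (\<theta> U s)"
      using bij_betw_inv_into_left[OF bij[OF V] species.transport_in[OF F U \<sigma> t]]
      unfolding \<theta>_def by simp
  qed
qed


section \<open>Orbits of injections\<close>

lemma injectionsD:
  assumes "f \<in> injections U A"
  shows "f \<in> U \<rightarrow>\<^sub>E A" "inj_on f U"
  using assms by (auto simp: injections_def)

lemma compose_injections:
  assumes f: "f \<in> injections U A" and \<rho>: "bij_betw \<rho> V U"
  shows "compose V f \<rho> \<in> injections V A"
proof -
  have "compose V f \<rho> \<in> V \<rightarrow>\<^sub>E A"
    using injectionsD(1)[OF f] bij_betwE[OF \<rho>] by (auto simp: compose_def)
  with inj_on_compose[OF \<rho> injectionsD(2)[OF f]] show ?thesis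
    by (simp add: injections_def)
qed

text \<open>
  Reindexing acts on arguments and the group acts on values, so the two commute. The index sets may
  have different types: this is what carries the finiteness of the number of orbits from sets of
  natural numbers to arbitrary finite sets.
\<close>

lemma reindex_orbit:
  assumes "\<And>y. y \<in> V \<Longrightarrow> \<rho> y \<in> U"
  shows "(\<lambda>f. compose V f \<rho>) ` orbit G (fun_action U \<phi>) f
    = orbit G (fun_action V \<phi>) (compose V f \<rho>)"
proof -
  have "compose V (compose U (\<phi> g) f) \<rho> = compose V (\<phi> g) (compose V f \<rho>)" for g
    using assms by (auto simp: compose_def fun_eq_iff)
  then show ?thesis
    unfolding orbit_def fun_action_def by (auto simp: image_def)
qed

lemma orbit_extensional:
  assumes "f \<in> orbit G (fun_action U \<phi>) k"
  shows "f \<in> extensional U"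
  using assms by (auto simp: orbit_def fun_action_def)

lemma in_structures_orbit_species:
  "s \<in> structures (orbit_species G A \<phi>) U
    \<longleftrightarrow> (\<exists>f\<in>injections U A. s = orbit G (fun_action U \<phi>) f)"
  by (auto simp: orbit_species_def orbits_def)

lemma orbit_in_structures:
  "f \<in> injections U A
    \<Longrightarrow> orbit G (fun_action U \<phi>) f \<in> structures (orbit_species G A \<phi>) U"
  by (auto simp: in_structures_orbit_species)

lemma transport_orbit_species:
  "transport (orbit_species G A \<phi>) U V \<sigma> X = (\<lambda>f. compose V f (inv_into U \<sigma>)) ` X"
  by (simp add: orbit_species_def)

lemma transport_orbit:
  assumes "bij_betw \<sigma> U V"
  shows "transport (orbit_species G A \<phi>) U V \<sigma> (orbit G (fun_action U \<phi>) f)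
    = orbit G (fun_action V \<phi>) (compose V f (inv_into U \<sigma>))"
  unfolding transport_orbit_species
  by (rule reindex_orbit) (use bij_betwE[OF bij_betw_inv_into[OF assms]] in blast)

text \<open>
  The functor laws follow from the commutation of relabelling with the action. Finiteness is left as
  a hypothesis because it has two sources: for \<open>G\<close> and \<open>H\<close> it is oligomorphy, for \<open>G \<times> H\<close> it will
  come from the bijection with the product species.
\<close>

lemma species_orbit_species:
  fixes G :: "('g, 'x) monoid_scheme" and A :: "'a set" and \<phi> :: "'g \<Rightarrow> 'a \<Rightarrow> 'a"
    and F :: "('u, ('u \<Rightarrow> 'a) set) pre_species"
  defines "F \<equiv> orbit_species G A \<phi>"
  assumes fin: "\<And>U. finite U \<Longrightarrow> finite (structures F U)"
  shows "species F"
proof (rule speciesI)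
  fix U V W :: "'u set" and \<sigma> \<sigma>' \<tau> :: "'u \<Rightarrow> 'u" and s
  assume s: "s \<in> structures F U"
  then obtain f where f: "f \<in> injections U A" and s_eq: "s = orbit G (fun_action U \<phi>) f"
    unfolding F_def in_structures_orbit_species by blast
  show "transport F U U id s = s"
  proof -
    have "compose U k (inv_into U id) = k" if "k \<in> s" for k
    proof -
      have "inv_into U id y = y" if "y \<in> U" for y
        using inv_into_f_f[of id U y] that by simp
      moreover have "k \<in> extensional U"
        using that orbit_extensional unfolding s_eq by blast
      ultimately show ?thesis
        by (auto simp: compose_def fun_eq_iff extensional_def)
    qed
    then show ?thesis
      unfolding F_def transport_orbit_species by simp
  qed
  assume \<sigma>: "bij_betw \<sigma> U V"
  show "transport F U V \<sigma> s \<in> structures F V"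
    unfolding s_eq F_def transport_orbit[OF \<sigma>]
    by (intro orbit_in_structures compose_injections[OF f] bij_betw_inv_into \<sigma>)
  show "transport F U V \<sigma> s = transport F U V \<sigma>' s" if eq: "\<And>x. x \<in> U \<Longrightarrow> \<sigma> x = \<sigma>' x"
  proof -
    have "inv_into U \<sigma> y = inv_into U \<sigma>' y" if "y \<in> V" for y
    proof -
      have \<sigma>': "bij_betw \<sigma>' U V" using \<sigma> bij_betw_cong[of U \<sigma> \<sigma>' V] eq by simp
      obtain x where "x \<in> U" "y = \<sigma> x" using \<open>y \<in> V\<close> bij_betw_imp_surj_on[OF \<sigma>] by blast
      then show ?thesis
        using bij_betw_inv_into_left[OF \<sigma>] bij_betw_inv_into_left[OF \<sigma>'] eq by metis
    qed
    then have "compose V k (inv_into U \<sigma>) = compose V k (inv_into U \<sigma>')" for k :: "'u \<Rightarrow> 'a"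
      by (auto simp: compose_def)
    then show ?thesis
      unfolding F_def transport_orbit_species by simp
  qed
  assume \<tau>: "bij_betw \<tau> V W"
  have "compose W f (inv_into U (\<tau> \<circ> \<sigma>)) = compose W (compose V f (inv_into U \<sigma>)) (inv_into V \<tau>)"
  proof -
    have inv_comp: "inv_into U (\<tau> \<circ> \<sigma>) w = inv_into U \<sigma> (inv_into V \<tau> w)" if "w \<in> W" for w
      using inv_into_comp[of \<tau> \<sigma> U w] \<sigma> \<tau> that by (simp add: bij_betw_def)
    have in_V: "inv_into V \<tau> w \<in> V" if "w \<in> W" for w
      using bij_betwE[OF bij_betw_inv_into[OF \<tau>]] that by blast
    show ?thesis
      using inv_comp in_V by (auto simp: compose_def fun_eq_iff)
  qed
  then show "transport F U W (\<tau> \<circ> \<sigma>) s = transport F V W \<tau> (transport F U V \<sigma> s)"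
    unfolding s_eq F_def transport_orbit[OF \<sigma>] transport_orbit[OF \<tau>]
      transport_orbit[OF bij_betw_trans[OF \<sigma> \<tau>]] by simp
qed (rule fin)

lemma (in oligomorphic) finite_orbits_funcset:
  assumes "finite (U :: 'u set)"
  shows "finite (orbits G (U \<rightarrow>\<^sub>E A) (fun_action U \<phi>))"
proof -
  obtain h where h: "bij_betw h {0..<card U} U"
    using ex_bij_betw_nat_finite[OF assms] by blast
  let ?N = "{0..<card U}"
  let ?\<rho> = "inv_into ?N h"
  have \<rho>: "?\<rho> y \<in> ?N" if "y \<in> U" for y
    using bij_betwE[OF bij_betw_inv_into[OF h]] that by blast
  have "orbits G (U \<rightarrow>\<^sub>E A) (fun_action U \<phi>)
    \<subseteq> (\<lambda>X. (\<lambda>f. compose U f ?\<rho>) ` X) ` orbits G (?N \<rightarrow>\<^sub>E A) (fun_action ?N \<phi>)"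
  proof
    fix X assume "X \<in> orbits G (U \<rightarrow>\<^sub>E A) (fun_action U \<phi>)"
    then obtain f where f: "f \<in> U \<rightarrow>\<^sub>E A" and X: "X = orbit G (fun_action U \<phi>) f"
      unfolding orbits_def by blast
    have "compose ?N f h \<in> ?N \<rightarrow>\<^sub>E A"
      using f bij_betwE[OF h] by (auto simp: compose_def)
    moreover have "compose U (compose ?N f h) ?\<rho> = f"
      using f \<rho> bij_betw_inv_into_right[OF h]
      by (auto simp: compose_def fun_eq_iff PiE_def extensional_def)
    then have "X = (\<lambda>f. compose U f ?\<rho>) ` orbit G (fun_action ?N \<phi>) (compose ?N f h)"
      using X by (simp add: reindex_orbit[where V = U and \<rho> = ?\<rho>, OF \<rho>])
    ultimately show
      "X \<in> (\<lambda>X. (\<lambda>f. compose U f ?\<rho>) ` X) ` orbits G (?N \<rightarrow>\<^sub>E A) (fun_action ?N \<phi>)"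
      unfolding orbits_def by blast
  qed
  then show ?thesis
    by (rule finite_subset) (intro finite_imageI finite_orbits finite_atLeastLessThan)
qed

lemma (in oligomorphic) species_orbit_species_oligomorphic:
  "species (orbit_species G A \<phi> :: ('u, ('u \<Rightarrow> 'a) set) pre_species)"
proof (rule species_orbit_species)
  fix U :: "'u set"
  assume U: "finite U"
  have
    "structures (orbit_species G A \<phi>) U \<subseteq> orbits G (U \<rightarrow>\<^sub>E A) (fun_action U \<phi>)"
    by (auto simp: orbit_species_def orbits_def injections_def)
  then show "finite (structures (orbit_species G A \<phi>) U)"
    by (rule finite_subset) (rule finite_orbits_funcset[OF U])
qed

context group_action
begin

lemma fun_action_injections:
  assumes "g \<in> carrier G" "f \<in> injections U E"
  shows "fun_action U \<phi> g f \<in> injections U E"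
proof -
  have f: "f x \<in> E" if "x \<in> U" for x
    using injectionsD(1)[OF assms(2)] that by auto
  have "\<phi> g (f x) \<in> E" if "x \<in> U" for x
    using element_image[OF assms(1) f[OF that]] by simp
  moreover have "inj_on (\<phi> g \<circ> f) U"
    using injectionsD(2)[OF assms(2)] inj_prop[OF assms(1)] f
    by (intro comp_inj_on) (auto intro: inj_on_subset)
  ultimately show ?thesis
    by (auto simp: injections_def fun_action_def compose_def inj_on_def)
qed

lemma orbit_fun_action_refl:
  assumes "f \<in> injections U E"
  shows "f \<in> orbit G (fun_action U \<phi>) f"
proof -
  have "fun_action U \<phi> \<one> f = f"
    using assms id_eq_one[symmetric]
    by (auto simp: injections_def fun_action_def compose_def fun_eq_iff PiE_def Pi_def
        extensional_def)
  moreover have "\<one> \<in> carrier G"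
    using group_hom by (simp add: group_hom_def group.is_monoid)
  ultimately show ?thesis
    unfolding orbit_def by force
qed

lemma orbit_fun_action_eq:
  assumes g: "g \<in> carrier G" and f: "f \<in> injections U E"
  shows "orbit G (fun_action U \<phi>) (fun_action U \<phi> g f) = orbit G (fun_action U \<phi>) f"
proof -
  interpret group G using group_hom by (simp add: group_hom_def)
  have mult: "fun_action U \<phi> h (fun_action U \<phi> g f) = fun_action U \<phi> (h \<otimes> g) f"
    if "h \<in> carrier G" for h
    using f composition_rule[OF _ that g]
    by (auto simp: injections_def fun_action_def compose_def fun_eq_iff PiE_def Pi_def)
  \<comment> \<open>Right translation by \<open>g\<close> permutes \<open>G\<close>.\<close>
  have "(\<lambda>h. h \<otimes> g) ` carrier G = carrier G"
  proof
    show "carrier G \<subseteq> (\<lambda>h. h \<otimes> g) ` carrier G"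
    proof
      fix x assume "x \<in> carrier G"
      then show "x \<in> (\<lambda>h. h \<otimes> g) ` carrier G"
        using g by (intro image_eqI[of _ _ "x \<otimes> inv g"]) (simp_all add: m_assoc)
    qed
  qed (use g in auto)
  from arg_cong[OF this, of "(`) (\<lambda>h. fun_action U \<phi> h f)"]
  have "(\<lambda>h. fun_action U \<phi> (h \<otimes> g) f) ` carrier G = (\<lambda>h. fun_action U \<phi> h f) ` carrier G"
    by (simp only: image_image)
  moreover have "(\<lambda>h. fun_action U \<phi> h (fun_action U \<phi> g f)) ` carrier G
    = (\<lambda>h. fun_action U \<phi> (h \<otimes> g) f) ` carrier G"
    using mult by (intro image_cong) auto
  ultimately show ?thesis
    unfolding orbit_def by (simp only: Setcompr_eq_image Collect_mem_eq)
qed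

end


section \<open>The modified arithmetic product of species\<close>

lemma block_image:
  assumes \<sigma>: "bij_betw \<sigma> U V" and \<pi>: "partition_on U \<pi>"
  shows "partition_on V ((`) \<sigma> ` \<pi>)" "bij_betw ((`) \<sigma>) \<pi> ((`) \<sigma> ` \<pi>)"
proof -
  have "{} \<notin> (`) \<sigma> ` \<pi>"
    using partition_onD3[OF \<pi>] by auto
  then show "partition_on V ((`) \<sigma> ` \<pi>)"
    using partition_on_inj_image[OF \<pi>, of \<sigma>] \<sigma> by (simp add: bij_betw_def)
  have "inj_on ((`) \<sigma>) (Pow U)"
    using \<sigma> by (simp add: bij_betw_def inj_on_image_Pow)
  moreover have "\<pi> \<subseteq> Pow U"
    using partition_onD1[OF \<pi>] by blast
  ultimately show "bij_betw ((`) \<sigma>) \<pi> ((`) \<sigma> ` \<pi>)"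
    by (auto intro: bij_betw_imageI inj_on_subset)
qed

lemma partial_rectanglesD:
  assumes "(\<pi>, \<tau>) \<in> partial_rectangles U"
  shows "partition_on U \<pi>" "partition_on U \<tau>"
  using assms by (auto simp: partial_rectangles_def)

lemma partial_rectangles_image:
  assumes \<sigma>: "bij_betw \<sigma> U V" and R: "(\<pi>, \<tau>) \<in> partial_rectangles U"
  shows "((`) \<sigma> ` \<pi>, (`) \<sigma> ` \<tau>) \<in> partial_rectangles V"
proof -
  note P = partial_rectanglesD[OF R]
  have "card (\<sigma> ` S \<inter> \<sigma> ` T) \<le> 1" if "S \<in> \<pi>" "T \<in> \<tau>" for S T
  proof -
    have ST: "S \<subseteq> U" "T \<subseteq> U" using that P[THEN partition_onD1] by auto
    have inj: "inj_on \<sigma> U" using \<sigma> by (simp add: bij_betw_def)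
    have "\<sigma> ` S \<inter> \<sigma> ` T = \<sigma> ` (S \<inter> T)"
      using inj_on_image_Int[OF inj ST] by simp
    moreover have "card (\<sigma> ` (S \<inter> T)) = card (S \<inter> T)"
      using inj_on_subset[OF inj] ST by (intro card_image) blast
    ultimately show ?thesis
      using R that by (auto simp: partial_rectangles_def)
  qed
  then show ?thesis
    using block_image(1)[OF \<sigma>] P by (auto simp: partial_rectangles_def)
qed

lemma in_structures_modified_arith_prod:
  "(\<pi>, \<tau>, m, n) \<in> structures (modified_arith_prod M N) U
    \<longleftrightarrow> (\<pi>, \<tau>) \<in> partial_rectangles U \<and> m \<in> structures M \<pi> \<and> n \<in> structures N \<tau>"
  by (simp add: modified_arith_prod_def)

lemma transport_modified_arith_prod:
  "transport (modified_arith_prod M N) U V \<sigma> (\<pi>, \<tau>, m, n) =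
     ((`) \<sigma> ` \<pi>, (`) \<sigma> ` \<tau>,
      transport M \<pi> ((`) \<sigma> ` \<pi>) ((`) \<sigma>) m, transport N \<tau> ((`) \<sigma> ` \<tau>) ((`) \<sigma>) n)"
  by (simp add: modified_arith_prod_def)

text \<open>
  Sending \<open>\<sigma>\<close> to the induced map on blocks respects identities and composition, so the functor laws
  are inherited from the two factors.
\<close>

lemma species_modified_arith_prod:
  fixes M :: "('u set, 's) pre_species" and N :: "('u set, 't) pre_species"
  assumes "species M" and "species N"
  shows "species (modified_arith_prod M N)"
proof -
  interpret M: species M by fact
  interpret N: species N by fact
  let ?F = "modified_arith_prod M N"
  show ?thesis
  proof (rule speciesI)
    fix U :: "'u set"
    assume U: "finite U"
    let ?P = "{\<pi>. partition_on U \<pi>}"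
    have "structures ?F U \<subseteq> ?P \<times> ?P \<times> (\<Union>\<pi>\<in>?P. structures M \<pi>) \<times> (\<Union>\<tau>\<in>?P. structures N \<tau>)"
      by (auto simp: modified_arith_prod_def partial_rectangles_def)
    moreover have "finite \<dots>"
      using finitely_many_partition_on[OF U] finite_elements[OF U]
        M.finite_structures N.finite_structures by (intro finite_cartesian_product) auto
    ultimately show "finite (structures ?F U)"
      by (rule finite_subset)
  next
    fix U V W :: "'u set" and \<sigma> \<sigma>' \<rho> :: "'u \<Rightarrow> 'u" and s
    assume U: "finite U" and s: "s \<in> structures ?F U"
    obtain \<pi> \<tau> m n where s_eq: "s = (\<pi>, \<tau>, m, n)" by (cases s)
    with s have R: "(\<pi>, \<tau>) \<in> partial_rectangles U"
      and m: "m \<in> structures M \<pi>" and n: "n \<in> structures N \<tau>"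
      by (simp_all add: in_structures_modified_arith_prod)
    note P = partial_rectanglesD[OF R]
    have fin: "finite \<pi>" "finite \<tau>" using P finite_elements[OF U] by auto
    have image_id: "(`) (id :: 'u \<Rightarrow> 'u) = id" by (simp add: fun_eq_iff)
    show "transport ?F U U id s = s"
      using M.transport_id[OF fin(1) m] N.transport_id[OF fin(2) n]
      by (simp add: s_eq transport_modified_arith_prod image_id)
    assume \<sigma>: "bij_betw \<sigma> U V"
    note b\<pi> = block_image[OF \<sigma> P(1)] and b\<tau> = block_image[OF \<sigma> P(2)]
    show "transport ?F U V \<sigma> s \<in> structures ?F V"
      using partial_rectangles_image[OF \<sigma> R] M.transport_in[OF fin(1) b\<pi>(2) m]
        N.transport_in[OF fin(2) b\<tau>(2) n]
      by (simp add: s_eq transport_modified_arith_prod in_structures_modified_arith_prod)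
    show "transport ?F U V \<sigma> s = transport ?F U V \<sigma>' s" if eq: "\<And>x. x \<in> U \<Longrightarrow> \<sigma> x = \<sigma>' x"
    proof -
      have blocks: "\<sigma> ` S = \<sigma>' ` S" if "S \<in> \<pi> \<or> S \<in> \<tau>" for S
      proof -
        have "S \<subseteq> U"
          using that partition_onD1[OF P(1)] partition_onD1[OF P(2)] by (metis Union_upper)
        then show ?thesis using eq by (intro image_cong) auto
      qed
      then have "(`) \<sigma> ` \<pi> = (`) \<sigma>' ` \<pi>" "(`) \<sigma> ` \<tau> = (`) \<sigma>' ` \<tau>"
        by (auto intro: image_cong)
      moreover have "transport M \<pi> ((`) \<sigma> ` \<pi>) ((`) \<sigma>) m = transport M \<pi> ((`) \<sigma> ` \<pi>) ((`) \<sigma>') m"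
        by (rule M.transport_cong[OF fin(1) b\<pi>(2) _ m]) (use blocks in blast)
      moreover have "transport N \<tau> ((`) \<sigma> ` \<tau>) ((`) \<sigma>) n = transport N \<tau> ((`) \<sigma> ` \<tau>) ((`) \<sigma>') n"
        by (rule N.transport_cong[OF fin(2) b\<tau>(2) _ n]) (use blocks in blast)
      ultimately show ?thesis
        by (simp add: s_eq transport_modified_arith_prod)
    qed
    assume \<rho>: "bij_betw \<rho> V W"
    have image_comp_eq: "(`) (\<rho> \<circ> \<sigma>) = (`) \<rho> \<circ> (`) \<sigma>"
      by (auto simp: fun_eq_iff)
    show "transport ?F U W (\<rho> \<circ> \<sigma>) s = transport ?F V W \<rho> (transport ?F U V \<sigma> s)"
      unfolding s_eq transport_modified_arith_prod image_comp_eq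
      using M.transport_comp[OF fin(1) b\<pi>(2) block_image(2)[OF \<rho> b\<pi>(1)] m]
        N.transport_comp[OF fin(2) b\<tau>(2) block_image(2)[OF \<rho> b\<tau>(1)] n]
      by (simp add: image_comp)
  qed
qed


section \<open>Functions as partitions with injectively labelled blocks\<close>

definition block_of :: "'u set set \<Rightarrow> 'u \<Rightarrow> 'u set" where
  "block_of \<pi> x = (THE S. S \<in> \<pi> \<and> x \<in> S)"

definition pullback :: "'u set \<Rightarrow> 'u set set \<Rightarrow> ('u set \<Rightarrow> 'a) \<Rightarrow> 'u \<Rightarrow> 'a" where
  "pullback U \<pi> p = compose U p (block_of \<pi>)"

lemma block_of_eq:
  assumes \<pi>: "partition_on U \<pi>" and S: "S \<in> \<pi>" "x \<in> S"
  shows "block_of \<pi> x = S"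
  unfolding block_of_def
proof (rule the_equality)
  show "T = S" if "T \<in> \<pi> \<and> x \<in> T" for T
    using that S partition_onD2[OF \<pi>] by (auto simp: disjoint_def)
qed (use S in simp)

lemma block_of_in:
  assumes \<pi>: "partition_on U \<pi>" and x: "x \<in> U"
  shows "block_of \<pi> x \<in> \<pi>" "x \<in> block_of \<pi> x"
proof -
  obtain S where S: "S \<in> \<pi>" "x \<in> S" using x partition_onD1[OF \<pi>] by auto
  with block_of_eq[OF \<pi> S] show "block_of \<pi> x \<in> \<pi>" "x \<in> block_of \<pi> x" by auto
qed

lemma pullback_apply: "x \<in> U \<Longrightarrow> pullback U \<pi> p x = p (block_of \<pi> x)"
  by (simp add: pullback_def compose_def)

lemma pullback_extensional: "pullback U \<pi> p \<in> extensional U"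
  by (simp add: pullback_def)

lemma pullback_in_funcset:
  assumes "partition_on U \<pi>" "p \<in> \<pi> \<rightarrow>\<^sub>E A"
  shows "pullback U \<pi> p \<in> U \<rightarrow>\<^sub>E A"
  using assms block_of_in(1)[OF assms(1)] by (auto simp: pullback_def compose_def)

lemma pullback_eq_iff:
  assumes \<pi>: "partition_on U \<pi>" and p: "inj_on p \<pi>" and xy: "x \<in> U" "y \<in> U"
  shows "pullback U \<pi> p x = pullback U \<pi> p y \<longleftrightarrow> block_of \<pi> x = block_of \<pi> y"
  using inj_on_eq_iff[OF p] block_of_in(1)[OF \<pi>] xy by (simp add: pullback_apply)

text \<open>An injective labelling makes the partition recoverable: its blocks are the fibres.\<close>

lemma partition_eq_fibres_pullback:
  assumes \<pi>: "partition_on U \<pi>" and p: "inj_on p \<pi>"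
  shows "\<pi> = (\<lambda>x. {y \<in> U. pullback U \<pi> p y = pullback U \<pi> p x}) ` U"
proof -
  have fibre: "{y \<in> U. pullback U \<pi> p y = pullback U \<pi> p x} = block_of \<pi> x" if x: "x \<in> U" for x
  proof -
    have "block_of \<pi> x \<subseteq> U"
      using block_of_in(1)[OF \<pi> x] partition_onD1[OF \<pi>] by blast
    moreover have "block_of \<pi> y = block_of \<pi> x \<longleftrightarrow> y \<in> block_of \<pi> x" if "y \<in> U" for y
      using block_of_eq[OF \<pi> block_of_in(1)[OF \<pi> x], of y] block_of_in(2)[OF \<pi> that] by auto
    ultimately show ?thesis
      using pullback_eq_iff[OF \<pi> p _ x] by blast
  qed
  have "\<pi> = block_of \<pi> ` U"
  proof
    show "\<pi> \<subseteq> block_of \<pi> ` U"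
    proof
      fix S assume S: "S \<in> \<pi>"
      then obtain x where "x \<in> S" using partition_onD3[OF \<pi>] by fastforce
      then show "S \<in> block_of \<pi> ` U"
        using S block_of_eq[OF \<pi> S] partition_onD1[OF \<pi>] by blast
    qed
  qed (use block_of_in(1)[OF \<pi>] in blast)
  with fibre show ?thesis by simp
qed

lemma pullback_inject:
  assumes \<pi>: "partition_on U \<pi>" and \<pi>': "partition_on U \<pi>'"
    and p: "p \<in> injections \<pi> A" and p': "p' \<in> injections \<pi>' A"
    and eq: "pullback U \<pi> p = pullback U \<pi>' p'"
  shows "\<pi> = \<pi>'" and "p = p'"
proof -
  show same: "\<pi> = \<pi>'"
    using partition_eq_fibres_pullback[OF \<pi> injectionsD(2)[OF p]]
      partition_eq_fibres_pullback[OF \<pi>' injectionsD(2)[OF p']] eq by simp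
  show "p = p'"
  proof (rule extensionalityI)
    show "p \<in> extensional \<pi>" "p' \<in> extensional \<pi>"
      using injectionsD(1)[OF p] injectionsD(1)[OF p'] same by (auto simp: PiE_def)
    fix S assume S: "S \<in> \<pi>"
    then obtain x where x: "x \<in> S" using partition_onD3[OF \<pi>] by fastforce
    then have "x \<in> U" using S partition_onD1[OF \<pi>] by blast
    then show "p S = p' S"
      using fun_cong[OF eq, of x] block_of_eq[OF \<pi> S x] same by (simp add: pullback_apply)
  qed
qed

text \<open>The partition is that into the fibres of \<open>k\<close>, labelled by the values of \<open>k\<close>.\<close>

lemma pullback_exists:
  assumes k: "k \<in> U \<rightarrow>\<^sub>E A"
  obtains \<pi> p where "partition_on U \<pi>" "p \<in> injections \<pi> A" "k = pullback U \<pi> p"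
proof
  define \<pi> where "\<pi> = (\<lambda>x. {y \<in> U. k y = k x}) ` U"
  define p where "p = (\<lambda>S\<in>\<pi>. k (SOME x. x \<in> S))"
  show \<pi>: "partition_on U \<pi>"
    by (rule partition_onI) (auto simp: \<pi>_def disjnt_def)
  \<comment> \<open>\<open>k\<close> is constant on each block, so the choice of the point does not matter.\<close>
  have p_block: "p S = k x" if S: "S \<in> \<pi>" "x \<in> S" for S x
  proof -
    have "(SOME x. x \<in> S) \<in> S" using S(2) by (rule someI)
    then have "k (SOME x. x \<in> S) = k x" using S by (auto simp: \<pi>_def)
    then show ?thesis using S by (simp add: p_def)
  qed
  have "p \<in> \<pi> \<rightarrow>\<^sub>E A"
  proof
    fix S assume S: "S \<in> \<pi>"
    then obtain x where x: "x \<in> U" "x \<in> S" unfolding \<pi>_def by blast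
    then show "p S \<in> A" using p_block[OF S] k by auto
  qed (simp add: p_def)
  moreover have "inj_on p \<pi>"
  proof (rule inj_onI)
    fix S T assume ST: "S \<in> \<pi>" "T \<in> \<pi>" "p S = p T"
    then obtain x y where "x \<in> U" "S = {z \<in> U. k z = k x}" "y \<in> U" "T = {z \<in> U. k z = k y}"
      unfolding \<pi>_def by blast
    moreover from this have "k x = k y"
      using p_block[OF ST(1), of x] p_block[OF ST(2), of y] ST(3) by simp
    ultimately show "S = T" by simp
  qed
  ultimately show "p \<in> injections \<pi> A" by (simp add: injections_def)
  show "k = pullback U \<pi> p"
  proof (rule extensionalityI[OF _ pullback_extensional])
    show "k \<in> extensional U" using k by (simp add: PiE_def)
    show "k x = pullback U \<pi> p x" if "x \<in> U" for x
      using p_block[OF block_of_in[OF \<pi> that]] that by (simp add: pullback_apply)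
  qed
qed

lemma pullback_fun_action:
  assumes "partition_on U \<pi>"
  shows "pullback U \<pi> (fun_action \<pi> \<phi> g p) = fun_action U \<phi> g (pullback U \<pi> p)"
  using block_of_in(1)[OF assms]
  by (auto simp: pullback_def fun_action_def compose_def fun_eq_iff)

text \<open>
  If \<open>y = \<sigma> x\<close>, the block of \<open>y\<close> in the relabelled partition is the image of the block of \<open>x\<close>, so both
  carry the same label. This is the naturality of the factorization.
\<close>

lemma pullback_transport:
  assumes \<sigma>: "bij_betw \<sigma> U V" and \<pi>: "partition_on U \<pi>"
  shows "pullback V ((`) \<sigma> ` \<pi>) (compose ((`) \<sigma> ` \<pi>) p (inv_into \<pi> ((`) \<sigma>)))
    = compose V (pullback U \<pi> p) (inv_into U \<sigma>)"
proof (rule extensionalityI[OF pullback_extensional compose_extensional])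
  fix y assume y: "y \<in> V"
  define x where "x = inv_into U \<sigma> y"
  have x: "x \<in> U" and \<sigma>x: "\<sigma> x = y"
    using bij_betwE[OF bij_betw_inv_into[OF \<sigma>]] bij_betw_inv_into_right[OF \<sigma>] y
    unfolding x_def by auto
  have S: "\<sigma> ` block_of \<pi> x \<in> (`) \<sigma> ` \<pi>"
    using block_of_in(1)[OF \<pi> x] by blast
  have "y \<in> \<sigma> ` block_of \<pi> x"
    using block_of_in(2)[OF \<pi> x] \<sigma>x by blast
  then have "block_of ((`) \<sigma> ` \<pi>) y = \<sigma> ` block_of \<pi> x"
    by (rule block_of_eq[OF block_image(1)[OF \<sigma> \<pi>] S])
  moreover have "inv_into \<pi> ((`) \<sigma>) (\<sigma> ` block_of \<pi> x) = block_of \<pi> x"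
    by (rule bij_betw_inv_into_left[OF block_image(2)[OF \<sigma> \<pi>] block_of_in(1)[OF \<pi> x]])
  ultimately show "pullback V ((`) \<sigma> ` \<pi>) (compose ((`) \<sigma> ` \<pi>) p (inv_into \<pi> ((`) \<sigma>))) y
    = compose V (pullback U \<pi> p) (inv_into U \<sigma>) y"
    using y x S by (simp add: pullback_apply compose_eq x_def[symmetric])
qed


section \<open>Gluing along a partial rectangle\<close>

definition pair :: "'u set \<Rightarrow> ('u \<Rightarrow> 'a) \<Rightarrow> ('u \<Rightarrow> 'b) \<Rightarrow> 'u \<Rightarrow> 'a \<times> 'b" where
  "pair U k l = (\<lambda>x\<in>U. (k x, l x))"

lemma pair_in_funcset: "k \<in> U \<rightarrow>\<^sub>E A \<Longrightarrow> l \<in> U \<rightarrow>\<^sub>E B \<Longrightarrow> pair U k l \<in> U \<rightarrow>\<^sub>E A \<times> B"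
  by (auto simp: pair_def)

lemma pair_exists:
  assumes "f \<in> U \<rightarrow>\<^sub>E A \<times> B"
  obtains k l where "k \<in> U \<rightarrow>\<^sub>E A" "l \<in> U \<rightarrow>\<^sub>E B" "f = pair U k l"
proof
  show "(\<lambda>x\<in>U. fst (f x)) \<in> U \<rightarrow>\<^sub>E A" "(\<lambda>x\<in>U. snd (f x)) \<in> U \<rightarrow>\<^sub>E B"
    using PiE_mem[OF assms] by (auto simp: mem_Times_iff)
  show "f = pair U (\<lambda>x\<in>U. fst (f x)) (\<lambda>x\<in>U. snd (f x))"
    using assms by (auto simp: pair_def fun_eq_iff PiE_def extensional_def)
qed

lemma pair_inject:
  assumes "k \<in> extensional U" "k' \<in> extensional U" "l \<in> extensional U" "l' \<in> extensional U"
    and "pair U k l = pair U k' l'"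
  shows "k = k'" "l = l'"
proof -
  have "k x = k' x \<and> l x = l' x" if "x \<in> U" for x
    using fun_cong[OF assms(5), of x] that by (simp add: pair_def)
  with assms show "k = k'" "l = l'" by (auto intro: extensionalityI)
qed

lemma pair_fun_action:
  assumes "k \<in> U \<rightarrow>\<^sub>E A" "l \<in> U \<rightarrow>\<^sub>E B"
  shows "fun_action U (prod_action A B \<phi> \<psi>) (g, h) (pair U k l)
    = pair U (fun_action U \<phi> g k) (fun_action U \<psi> h l)"
  using assms by (auto simp: fun_action_def prod_action_def pair_def compose_def fun_eq_iff)

lemma compose_pair:
  assumes "\<And>y. y \<in> V \<Longrightarrow> \<rho> y \<in> U"
  shows "compose V (pair U k l) \<rho> = pair V (compose V k \<rho>) (compose V l \<rho>)"
  using assms by (auto simp: compose_def pair_def fun_eq_iff)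

text \<open>
  Two points have the same image under the glued function if and only if they lie in the same block
  of both partitions.
\<close>

lemma inj_on_pair_pullback_iff:
  assumes U: "finite U" and \<pi>: "partition_on U \<pi>" and \<tau>: "partition_on U \<tau>"
    and p: "inj_on p \<pi>" and q: "inj_on q \<tau>"
  shows "inj_on (pair U (pullback U \<pi> p) (pullback U \<tau> q)) U
    \<longleftrightarrow> (\<pi>, \<tau>) \<in> partial_rectangles U"
proof -
  have "inj_on (pair U (pullback U \<pi> p) (pullback U \<tau> q)) U \<longleftrightarrow>
    (\<forall>x\<in>U. \<forall>y\<in>U. block_of \<pi> x = block_of \<pi> y \<and> block_of \<tau> x = block_of \<tau> y \<longrightarrow> x = y)"
    using pullback_eq_iff[OF \<pi> p] pullback_eq_iff[OF \<tau> q]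
    by (auto simp: inj_on_def pair_def)
  also have "\<dots> \<longleftrightarrow> (\<forall>S\<in>\<pi>. \<forall>T\<in>\<tau>. \<forall>x\<in>S \<inter> T. \<forall>y\<in>S \<inter> T. x = y)" (is "?L \<longleftrightarrow> ?R")
  proof
    assume L: ?L
    show ?R
    proof (intro ballI)
      fix S T x y assume ST: "S \<in> \<pi>" "T \<in> \<tau>" and xy: "x \<in> S \<inter> T" "y \<in> S \<inter> T"
      then have "block_of \<pi> x = block_of \<pi> y" "block_of \<tau> x = block_of \<tau> y"
        using block_of_eq[OF \<pi> ST(1)] block_of_eq[OF \<tau> ST(2)] by auto
      moreover have "x \<in> U" "y \<in> U" using ST xy partition_onD1[OF \<pi>] by auto
      ultimately show "x = y" using L by blast
    qed
  next
    assume R: ?R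
    show ?L
      using R block_of_in[OF \<pi>] block_of_in[OF \<tau>] by (metis IntI)
  qed
  also have "\<dots> \<longleftrightarrow> (\<forall>S\<in>\<pi>. \<forall>T\<in>\<tau>. card (S \<inter> T) \<le> 1)"
  proof -
    have "finite (S \<inter> T)" if "S \<in> \<pi>" for S T
      using that U partition_onD1[OF \<pi>] by (auto intro: finite_subset[of _ U])
    then show ?thesis by (simp add: card_le_Suc0_iff_eq)
  qed
  finally show ?thesis
    using \<pi> \<tau> by (simp add: partial_rectangles_def)
qed

definition glue ::
  "'u set \<Rightarrow> 'u set set \<times> 'u set set \<times> ('u set \<Rightarrow> 'a) set \<times> ('u set \<Rightarrow> 'b) set
    \<Rightarrow> ('u \<Rightarrow> 'a \<times> 'b) set"
where
  "glue U = (\<lambda>(\<pi>, \<tau>, m, n).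
     {pair U (pullback U \<pi> p) (pullback U \<tau> q) | p q. p \<in> m \<and> q \<in> n})"

lemma pair_pullback_fun_action:
  assumes \<pi>: "partition_on U \<pi>" and \<tau>: "partition_on U \<tau>"
    and p: "p \<in> injections \<pi> A" and q: "q \<in> injections \<tau> B"
  shows "fun_action U (prod_action A B \<phi> \<psi>) (g, h)
      (pair U (pullback U \<pi> p) (pullback U \<tau> q))
    = pair U (pullback U \<pi> (fun_action \<pi> \<phi> g p)) (pullback U \<tau> (fun_action \<tau> \<psi> h q))"
  by (simp add: pair_fun_action[OF pullback_in_funcset[OF \<pi> injectionsD(1)[OF p]]
        pullback_in_funcset[OF \<tau> injectionsD(1)[OF q]]]
      pullback_fun_action[OF \<pi>] pullback_fun_action[OF \<tau>])

text \<open>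
  This is where the product of two orbits becomes a single orbit: \<open>g\<close> and \<open>h\<close> range independently of
  each other over the two groups.
\<close>

lemma glue_orbits:
  assumes "partition_on U \<pi>" "partition_on U \<tau>"
    and "p \<in> injections \<pi> A" "q \<in> injections \<tau> B"
  shows "glue U (\<pi>, \<tau>, orbit G (fun_action \<pi> \<phi>) p, orbit H (fun_action \<tau> \<psi>) q)
    = orbit (G \<times>\<times> H) (fun_action U (prod_action A B \<phi> \<psi>))
        (pair U (pullback U \<pi> p) (pullback U \<tau> q))"
proof -
  have "glue U (\<pi>, \<tau>, orbit G (fun_action \<pi> \<phi>) p, orbit H (fun_action \<tau> \<psi>) q)
    = {pair U (pullback U \<pi> (fun_action \<pi> \<phi> g p)) (pullback U \<tau> (fun_action \<tau> \<psi> h q)) | g h.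
        g \<in> carrier G \<and> h \<in> carrier H}"
    unfolding glue_def orbit_def by auto
  also have "\<dots> = {fun_action U (prod_action A B \<phi> \<psi>) (g, h)
      (pair U (pullback U \<pi> p) (pullback U \<tau> q)) | g h. g \<in> carrier G \<and> h \<in> carrier H}"
    by (simp only: pair_pullback_fun_action[OF assms])
  also have "\<dots> = orbit (G \<times>\<times> H) (fun_action U (prod_action A B \<phi> \<psi>))
      (pair U (pullback U \<pi> p) (pullback U \<tau> q))"
    unfolding orbit_def by auto
  finally show ?thesis .
qed

text \<open>
  Both directions rest on the factorization of functions through their fibres: surjectivity is its
  existence. For injectivity, equal orbits contain a common function; its unique factorization
  determines the partitions, and determines \<open>p\<close> and \<open>q\<close> up to the action of \<open>G\<close> and of \<open>H\<close>.
\<close>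

lemma bij_betw_glue:
  fixes G :: "('g, 'x) monoid_scheme" and H :: "('h, 'y) monoid_scheme"
    and U :: "'u set"
  assumes "group_action G A \<phi>" and "group_action H B \<psi>" and U: "finite U"
  shows "bij_betw (glue U)
    (structures (modified_arith_prod (orbit_species G A \<phi>) (orbit_species H B \<psi>)) U)
    (structures (orbit_species (G \<times>\<times> H) (A \<times> B) (prod_action A B \<phi> \<psi>)) U)"
    (is "bij_betw _ ?P ?Q")
proof -
  interpret G: group_action G A \<phi> by fact
  interpret H: group_action H B \<psi> by fact
  let ?glued = "\<lambda>\<pi> \<tau> p q. pair U (pullback U \<pi> p) (pullback U \<tau> q)"
  let ?orb = "orbit (G \<times>\<times> H) (fun_action U (prod_action A B \<phi> \<psi>))"
  let ?orbG = "\<lambda>\<pi>. orbit G (fun_action \<pi> \<phi>)"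
  let ?orbH = "\<lambda>\<tau>. orbit H (fun_action \<tau> \<psi>)"
  have glued_injections: "?glued \<pi> \<tau> p q \<in> injections U (A \<times> B)"
    if R: "(\<pi>, \<tau>) \<in> partial_rectangles U" and p: "p \<in> injections \<pi> A" and q: "q \<in> injections \<tau> B"
    for \<pi> \<tau> p q
  proof -
    note P = partial_rectanglesD[OF R]
    have "?glued \<pi> \<tau> p q \<in> U \<rightarrow>\<^sub>E A \<times> B"
      by (intro pair_in_funcset pullback_in_funcset P injectionsD(1) p q)
    then show ?thesis
      using inj_on_pair_pullback_iff[OF U P injectionsD(2)[OF p] injectionsD(2)[OF q]] R
      by (simp add: injections_def)
  qed
  have elem: "\<exists>\<pi> \<tau> p q. s = (\<pi>, \<tau>, ?orbG \<pi> p, ?orbH \<tau> q) \<and> (\<pi>, \<tau>) \<in> partial_rectangles U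
      \<and> p \<in> injections \<pi> A \<and> q \<in> injections \<tau> B" if "s \<in> ?P" for s
    using that
    by (cases s) (auto simp: in_structures_modified_arith_prod in_structures_orbit_species)
  show ?thesis
  proof (rule bij_betw_imageI)
    show "inj_on (glue U) ?P"
    proof (rule inj_onI)
      fix s s' assume s: "s \<in> ?P" and s': "s' \<in> ?P" and eq: "glue U s = glue U s'"
      from elem[OF s] obtain \<pi> \<tau> p q where
        s_eq: "s = (\<pi>, \<tau>, ?orbG \<pi> p, ?orbH \<tau> q)" and R: "(\<pi>, \<tau>) \<in> partial_rectangles U"
        and p: "p \<in> injections \<pi> A" and q: "q \<in> injections \<tau> B" by blast
      from elem[OF s'] obtain \<pi>' \<tau>' p' q' where
        s'_eq: "s' = (\<pi>', \<tau>', ?orbG \<pi>' p', ?orbH \<tau>' q')" and R': "(\<pi>', \<tau>') \<in> partial_rectangles U"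
        and p': "p' \<in> injections \<pi>' A" and q': "q' \<in> injections \<tau>' B" by blast
      note P = partial_rectanglesD[OF R] and P' = partial_rectanglesD[OF R']
      \<comment> \<open>The function glued from \<open>p'\<close> and \<open>q'\<close> is also glued from some \<open>g \<circ> p\<close> and \<open>h \<circ> q\<close>, and the
        factorization is unique.\<close>
      have "?glued \<pi>' \<tau>' p' q' \<in> glue U s'"
        using G.orbit_fun_action_refl[OF p'] H.orbit_fun_action_refl[OF q']
        unfolding s'_eq glue_def by auto
      then have "?glued \<pi>' \<tau>' p' q' \<in> glue U s" using eq by simp
      then obtain g h where g: "g \<in> carrier G" and h: "h \<in> carrier H"
        and glued: "?glued \<pi>' \<tau>' p' q' = ?glued \<pi> \<tau> (fun_action \<pi> \<phi> g p) (fun_action \<tau> \<psi> h q)"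
        unfolding s_eq glue_def orbit_def by auto
      have gp: "fun_action \<pi> \<phi> g p \<in> injections \<pi> A"
        and hq: "fun_action \<tau> \<psi> h q \<in> injections \<tau> B"
        using G.fun_action_injections[OF g p] H.fun_action_injections[OF h q] by auto
      note eqs = pair_inject[OF pullback_extensional pullback_extensional pullback_extensional
          pullback_extensional glued]
      have "\<pi>' = \<pi>" "p' = fun_action \<pi> \<phi> g p"
        using pullback_inject[OF P'(1) P(1) p' gp eqs(1)] by auto
      moreover have "\<tau>' = \<tau>" "q' = fun_action \<tau> \<psi> h q"
        using pullback_inject[OF P'(2) P(2) q' hq eqs(2)] by auto
      ultimately show "s = s'"
        using G.orbit_fun_action_eq[OF g p] H.orbit_fun_action_eq[OF h q]
        by (simp add: s_eq s'_eq)
    qed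
    show "glue U ` ?P = ?Q"
    proof
      show "glue U ` ?P \<subseteq> ?Q"
      proof
        fix X assume "X \<in> glue U ` ?P"
        then obtain s where s: "s \<in> ?P" "X = glue U s" by blast
        from elem[OF s(1)] obtain \<pi> \<tau> p q where
          s_eq: "s = (\<pi>, \<tau>, ?orbG \<pi> p, ?orbH \<tau> q)" and R: "(\<pi>, \<tau>) \<in> partial_rectangles U"
          and p: "p \<in> injections \<pi> A" and q: "q \<in> injections \<tau> B" by blast
        have "X = ?orb (?glued \<pi> \<tau> p q)"
          unfolding s(2) s_eq by (rule glue_orbits[OF partial_rectanglesD[OF R] p q])
        then show "X \<in> ?Q"
          by (simp only: orbit_in_structures[OF glued_injections[OF R p q]])
      qed
      show "?Q \<subseteq> glue U ` ?P"
      proof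
        fix X assume "X \<in> ?Q"
        then obtain f where f: "f \<in> injections U (A \<times> B)" and X: "X = ?orb f"
          unfolding in_structures_orbit_species by blast
        obtain k l where k: "k \<in> U \<rightarrow>\<^sub>E A" and l: "l \<in> U \<rightarrow>\<^sub>E B" and f_eq: "f = pair U k l"
          using pair_exists[OF injectionsD(1)[OF f]] .
        obtain \<pi> p where \<pi>: "partition_on U \<pi>" and p: "p \<in> injections \<pi> A"
          and k_eq: "k = pullback U \<pi> p" using pullback_exists[OF k] .
        obtain \<tau> q where \<tau>: "partition_on U \<tau>" and q: "q \<in> injections \<tau> B"
          and l_eq: "l = pullback U \<tau> q" using pullback_exists[OF l] .
        have "(\<pi>, \<tau>) \<in> partial_rectangles U"
          using inj_on_pair_pullback_iff[OF U \<pi> \<tau> injectionsD(2)[OF p] injectionsD(2)[OF q]]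
            injectionsD(2)[OF f] by (simp add: f_eq k_eq l_eq)
        then have "(\<pi>, \<tau>, ?orbG \<pi> p, ?orbH \<tau> q) \<in> ?P"
          by (simp add: in_structures_modified_arith_prod orbit_in_structures p q)
        moreover have "X = glue U (\<pi>, \<tau>, ?orbG \<pi> p, ?orbH \<tau> q)"
          by (simp add: glue_orbits[OF \<pi> \<tau> p q] X f_eq k_eq l_eq)
        ultimately show "X \<in> glue U ` ?P" by blast
      qed
    qed
  qed
qed

lemma glue_natural:
  fixes G :: "('g, 'x) monoid_scheme" and H :: "('h, 'y) monoid_scheme"
    and A :: "'a set" and B :: "'b set" and U V :: "'u set"
  assumes \<sigma>: "bij_betw \<sigma> U V"
    and s: "s \<in> structures (modified_arith_prod (orbit_species G A \<phi>) (orbit_species H B \<psi>)) U"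
  shows "glue V (transport (modified_arith_prod (orbit_species G A \<phi>) (orbit_species H B \<psi>)) U V \<sigma> s)
    = transport (orbit_species (G \<times>\<times> H) (A \<times> B) (prod_action A B \<phi> \<psi>)) U V \<sigma> (glue U s)"
    (is "glue V (transport ?F U V \<sigma> s) = _")
proof -
  obtain \<pi> \<tau> m n where s_eq: "s = (\<pi>, \<tau>, m, n)" by (cases s)
  with s have R: "(\<pi>, \<tau>) \<in> partial_rectangles U"
    by (simp add: in_structures_modified_arith_prod)
  note P = partial_rectanglesD[OF R]
  have "inv_into U \<sigma> y \<in> U" if "y \<in> V" for y
    using bij_betwE[OF bij_betw_inv_into[OF \<sigma>]] that by blast
  then have *: "compose V (pair U (pullback U \<pi> p) (pullback U \<tau> q)) (inv_into U \<sigma>)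
    = pair V (pullback V ((`) \<sigma> ` \<pi>) (compose ((`) \<sigma> ` \<pi>) p (inv_into \<pi> ((`) \<sigma>))))
        (pullback V ((`) \<sigma> ` \<tau>) (compose ((`) \<sigma> ` \<tau>) q (inv_into \<tau> ((`) \<sigma>))))"
    for p :: "'u set \<Rightarrow> 'a" and q :: "'u set \<Rightarrow> 'b"
    unfolding pullback_transport[OF \<sigma> P(1)] pullback_transport[OF \<sigma> P(2)] by (rule compose_pair)
  have "glue V (transport ?F U V \<sigma> s)
    = {pair V (pullback V ((`) \<sigma> ` \<pi>) (compose ((`) \<sigma> ` \<pi>) p (inv_into \<pi> ((`) \<sigma>))))
        (pullback V ((`) \<sigma> ` \<tau>) (compose ((`) \<sigma> ` \<tau>) q (inv_into \<tau> ((`) \<sigma>)))) | p q.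
        p \<in> m \<and> q \<in> n}"
    unfolding s_eq transport_modified_arith_prod transport_orbit_species glue_def by auto
  also have "\<dots> = {compose V (pair U (pullback U \<pi> p) (pullback U \<tau> q)) (inv_into U \<sigma>) | p q.
      p \<in> m \<and> q \<in> n}"
    by (simp only: *)
  also have "\<dots> = (\<lambda>f. compose V f (inv_into U \<sigma>)) ` glue U s"
    unfolding s_eq glue_def by auto
  finally show ?thesis
    unfolding transport_orbit_species .
qed

theorem theorem5p1:
  fixes G :: "('g, 'x) monoid_scheme" and H :: "('h, 'y) monoid_scheme"
    and A :: "'a set" and B :: "'b set"
    and \<phi> :: "'g \<Rightarrow> 'a \<Rightarrow> 'a" and \<psi> :: "'h \<Rightarrow> 'b \<Rightarrow> 'b"
  assumes "countable A" and "countable B"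
    and "oligomorphic G A \<phi>" and "oligomorphic H B \<psi>"
  shows "species_iso
           (orbit_species (G \<times>\<times> H) (A \<times> B) (prod_action A B \<phi> \<psi>)
             :: ('u, ('u \<Rightarrow> 'a \<times> 'b) set) pre_species)
           (modified_arith_prod (orbit_species G A \<phi>) (orbit_species H B \<psi>))"
    (is "species_iso ?Q ?P")
proof (rule species_iso_sym)
  interpret G: oligomorphic G A \<phi> by fact
  interpret H: oligomorphic H B \<psi> by fact
  have bij: "bij_betw (glue U) (structures ?P U) (structures ?Q U)" if "finite U" for U
    by (rule bij_betw_glue[OF G.group_action_axioms H.group_action_axioms that])
  have P: "species ?P"
    by (intro species_modified_arith_prod G.species_orbit_species_oligomorphic
        H.species_orbit_species_oligomorphic)
  have Q: "species ?Q"
  proof (rule species_orbit_species)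
    show "finite (structures ?Q U)" if "finite U" for U :: "'u set"
      using bij_betw_finite[OF bij[OF that]] species.finite_structures[OF P that] by simp
  qed
  show "species_iso ?P ?Q"
    by (rule species_isoI[OF P Q]) (erule bij, erule (1) glue_natural)
qed

end
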